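(* Let $f \in \mathbb{R}[x]$ be a non-constant univariate polynomial, regarded as a smooth function on $\mathbb{R}$. The following are equivalent: (a) $f$ is g-convex with respect to some connection on $\mathbb{R}$. (b) $f$ is g-convex with respect to (the Levi-Civita connection of) some Riemannian metric on $\mathbb{R}$. (c) One of the following holds: (i) $f$ has no critical point (in $\mathbb{R}$); (ii) $f'(x)=(x-u)^{2r-1}p(x)$ for some real number $u$, some integer $r\ge 1$ and some $p \in \mathbb{R}[x]$ such that $p(x) > 0$ for all $x\in\mathbb{R}$.
   Context: A connection means a smooth torsion-free affine connection $\nabla$ ($\nabla_XY-\nabla_YX=[X,Y]$). A smooth function $f$ on a manifold $\mathcal{M}$ is g-convex with respect to $\nabla$ if $f\circ\gamma:[0,1]\to\mathbb{R}$ is convex for every $\nabla$-geodesic $\gamma:[0,1]\to\mathcal{M}$; equivalently, $\mathrm{Hess}_\nabla f(X,Y)=X(Y(f))-(\nabla_XY)(f)$ is positive semidefinite at every point. *)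

theory Defs
  imports "HOL-Analysis.Analysis" "HOL-Computational_Algebra.Polynomial"
begin

text \<open>
  Smoothness on \<open>S\<close>: all iterated derivatives relative to \<open>S\<close> exist. It is used only for
  \<open>S = UNIV\<close> and for \<open>S = {0..1}\<close>, where the derivatives at the endpoints are one-sided.
\<close>

definition deriv_on :: "real set \<Rightarrow> (real \<Rightarrow> real) \<Rightarrow> real \<Rightarrow> real" where
  "deriv_on S f t = vector_derivative f (at t within S)"

definition smooth_on :: "real set \<Rightarrow> (real \<Rightarrow> real) \<Rightarrow> bool" where
  "smooth_on S f \<longleftrightarrow> (\<forall>n. \<forall>t\<in>S. ((deriv_on S ^^ n) f) differentiable (at t within S))"

abbreviation smooth :: "(real \<Rightarrow> real) \<Rightarrow> bool" where
  "smooth \<equiv> smooth_on UNIV"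

text \<open>
  The coordinate vector field \<open>\<partial>\<close> trivialises the tangent bundle of the real line, so the vector
  field \<open>X \<partial>\<close> is represented by its component function \<open>X\<close>, and \<open>\<partial>\<close> itself by \<open>\<lambda>x. 1\<close>.
\<close>

definition dir_deriv :: "(real \<Rightarrow> real) \<Rightarrow> (real \<Rightarrow> real) \<Rightarrow> real \<Rightarrow> real" where
  "dir_deriv X \<phi> = (\<lambda>x. X x * deriv \<phi> x)"

text \<open>
  The bracket is determined by \<open>[X, Y](\<phi>) = X(Y(\<phi>)) - Y(X(\<phi>))\<close>; the second derivatives of \<open>\<phi>\<close>
  cancel, leaving the component \<open>X Y' - Y X'\<close>.
\<close>

definition lie_bracket :: "(real \<Rightarrow> real) \<Rightarrow> (real \<Rightarrow> real) \<Rightarrow> real \<Rightarrow> real" where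
  "lie_bracket X Y = (\<lambda>x. dir_deriv X Y x - dir_deriv Y X x)"

type_synonym connection = "(real \<Rightarrow> real) \<Rightarrow> (real \<Rightarrow> real) \<Rightarrow> real \<Rightarrow> real"

text \<open>Only the values of \<open>D X Y\<close> at smooth vector fields \<open>X\<close>, \<open>Y\<close> are constrained.\<close>

definition affine_connection :: "connection \<Rightarrow> bool" where
  "affine_connection D \<longleftrightarrow>
     (\<forall>X Y. smooth X \<longrightarrow> smooth Y \<longrightarrow> smooth (D X Y)) \<and>
     (\<forall>\<phi> \<psi> X Z Y. smooth \<phi> \<longrightarrow> smooth \<psi> \<longrightarrow> smooth X \<longrightarrow> smooth Z \<longrightarrow> smooth Y \<longrightarrow>
        D (\<lambda>x. \<phi> x * X x + \<psi> x * Z x) Y = (\<lambda>x. \<phi> x * D X Y x + \<psi> x * D Z Y x)) \<and>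
     (\<forall>a b X Y Z. smooth X \<longrightarrow> smooth Y \<longrightarrow> smooth Z \<longrightarrow>
        D X (\<lambda>x. a * Y x + b * Z x) = (\<lambda>x. a * D X Y x + b * D X Z x)) \<and>
     (\<forall>\<phi> X Y. smooth \<phi> \<longrightarrow> smooth X \<longrightarrow> smooth Y \<longrightarrow>
        D X (\<lambda>x. \<phi> x * Y x) = (\<lambda>x. dir_deriv X \<phi> x * Y x + \<phi> x * D X Y x))"

definition torsion_free :: "connection \<Rightarrow> bool" where
  "torsion_free D \<longleftrightarrow>
     (\<forall>X Y. smooth X \<longrightarrow> smooth Y \<longrightarrow> (\<lambda>x. D X Y x - D Y X x) = lie_bracket X Y)"

definition is_connection :: "connection \<Rightarrow> bool" where
  "is_connection D \<longleftrightarrow> affine_connection D \<and> torsion_free D"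

definition christoffel :: "connection \<Rightarrow> real \<Rightarrow> real" where
  "christoffel D = D (\<lambda>x. 1) (\<lambda>x. 1)"

text \<open>
  Covariant derivative of a vector field \<open>V\<close> along a curve \<open>\<gamma> : [0,1] \<rightarrow> \<real>\<close>; it is the
  operator with the Leibniz rule that sends \<open>Y \<circ> \<gamma>\<close> to \<open>\<nabla>\<^bsub>\<gamma>'\<^esub> Y\<close>.
\<close>

definition cov_deriv_along :: "connection \<Rightarrow> (real \<Rightarrow> real) \<Rightarrow> (real \<Rightarrow> real) \<Rightarrow> real \<Rightarrow> real" where
  "cov_deriv_along D \<gamma> V t =
     deriv_on {0..1} V t + christoffel D (\<gamma> t) * deriv_on {0..1} \<gamma> t * V t"

definition geodesic :: "connection \<Rightarrow> (real \<Rightarrow> real) \<Rightarrow> bool" where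
  "geodesic D \<gamma> \<longleftrightarrow> smooth_on {0..1} \<gamma> \<and>
     (\<forall>t\<in>{0..1}. cov_deriv_along D \<gamma> (deriv_on {0..1} \<gamma>) t = 0)"

definition g_convex :: "connection \<Rightarrow> (real \<Rightarrow> real) \<Rightarrow> bool" where
  "g_convex D f \<longleftrightarrow> (\<forall>\<gamma>. geodesic D \<gamma> \<longrightarrow> convex_on {0..1} (f \<circ> \<gamma>))"

text \<open>\<open>g x v w\<close> is the inner product at \<open>x\<close> of the tangent vectors with components \<open>v\<close>, \<open>w\<close>.\<close>

definition riemannian_metric :: "(real \<Rightarrow> real \<Rightarrow> real \<Rightarrow> real) \<Rightarrow> bool" where
  "riemannian_metric g \<longleftrightarrow>
     (\<forall>x. bilinear (g x) \<and> (\<forall>v w. g x v w = g x w v) \<and> (\<forall>v. v \<noteq> 0 \<longrightarrow> g x v v > 0)) \<and>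
     (\<forall>X Y. smooth X \<longrightarrow> smooth Y \<longrightarrow> smooth (\<lambda>x. g x (X x) (Y x)))"

definition metric_compatible :: "(real \<Rightarrow> real \<Rightarrow> real \<Rightarrow> real) \<Rightarrow> connection \<Rightarrow> bool" where
  "metric_compatible g D \<longleftrightarrow>
     (\<forall>X Y Z. smooth X \<longrightarrow> smooth Y \<longrightarrow> smooth Z \<longrightarrow>
        dir_deriv X (\<lambda>x. g x (Y x) (Z x)) = (\<lambda>x. g x (D X Y x) (Z x) + g x (Y x) (D X Z x)))"

text \<open>
  A predicate rather than a function of \<open>g\<close>, because uniqueness of the Levi-Civita connection
  concerns its values at smooth vector fields only; \<open>christoffel\<close>, hence \<open>g_convex\<close>, depends
  on nothing else.
\<close>

definition levi_civita :: "(real \<Rightarrow> real \<Rightarrow> real \<Rightarrow> real) \<Rightarrow> connection \<Rightarrow> bool" where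
  "levi_civita g D \<longleftrightarrow> is_connection D \<and> metric_compatible g D"

end

theory Submission
  imports Defs
begin

text \<open>
  In the coordinate of the line a connection is a single smooth function \<open>\<Gamma>\<close>, its Christoffel
  symbol, and the Hessian of \<open>f\<close> is \<open>f'' - \<Gamma> f'\<close>. If \<open>f' = q p\<close> with \<open>p\<close> nowhere zero and
  \<open>q' p \<ge> 0\<close>, the metric \<open>p\<^sup>2 dx\<^sup>2\<close> has \<open>\<Gamma> = p'/p\<close> and Hessian \<open>q' p\<close>; take \<open>q = 1\<close> when there is no
  critical point and \<open>q = (x - u) ^ (2 r - 1)\<close> otherwise.

  Conversely, let \<open>\<Phi>' = exp G\<close> with \<open>G' = \<Gamma>\<close>. A curve is a geodesic exactly if \<open>\<Phi>\<close> maps it to a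
  curve of constant speed, so any two points are joined by a geodesic. A convex function with
  vanishing derivative at \<open>0\<close> is minimal there, so every critical point of \<open>f\<close> is a global minimum.
  Two of them would force \<open>f\<close> to be constant on the geodesic between them, so there is only one,
  and \<open>f'\<close> changes sign from negative to positive at it.
\<close>

section \<open>Smooth functions\<close>

text \<open>Closed only under the operations that differentiation preserves by the sum and product
  rules; constants, reciprocals and exponentials have to come in as generators.\<close>

inductive_set function_algebra :: "(real \<Rightarrow> real) set \<Rightarrow> (real \<Rightarrow> real) set" for F where
  gen: "\<phi> \<in> F \<Longrightarrow> \<phi> \<in> function_algebra F"
| add: "\<phi> \<in> function_algebra F \<Longrightarrow> \<psi> \<in> function_algebra F \<Longrightarrow> (\<lambda>x. \<phi> x + \<psi> x) \<in> function_algebra F"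
| mult: "\<phi> \<in> function_algebra F \<Longrightarrow> \<psi> \<in> function_algebra F \<Longrightarrow> (\<lambda>x. \<phi> x * \<psi> x) \<in> function_algebra F"

lemma deriv_on_eqI:
  assumes "at t within S \<noteq> bot" "(f has_real_derivative d) (at t within S)"
  shows "deriv_on S f t = d"
  using assms vector_derivative_within[of t S f d]
  by (simp add: deriv_on_def has_real_derivative_iff_has_vector_derivative)

lemma has_real_derivative_cong_on:
  assumes "(g has_real_derivative d) (at t within S)" "\<forall>x\<in>S. f x = g x" "t \<in> S"
  shows "(f has_real_derivative d) (at t within S)"
  using assms(1) by (rule has_field_derivative_transform_within[of _ _ _ _ 1]) (use assms in auto)

text \<open>
  Coinduction up to sums and products: the product rule keeps the generated algebra closed under
  derivatives, so no Leibniz formula for higher derivatives is needed.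
\<close>

lemma smooth_on_coinduct:
  assumes nontriv: "\<And>t. t \<in> S \<Longrightarrow> at t within S \<noteq> bot"
    and F: "\<And>\<phi>. \<phi> \<in> F \<Longrightarrow> \<exists>\<psi>\<in>function_algebra F. \<forall>t\<in>S. (\<phi> has_real_derivative \<psi> t) (at t within S)"
    and f: "f \<in> function_algebra F"
  shows "smooth_on S f"
proof -
  have step: "\<exists>\<psi>\<in>function_algebra F. \<forall>t\<in>S. (\<phi> has_real_derivative \<psi> t) (at t within S)"
    if "\<phi> \<in> function_algebra F" for \<phi>
    using that
  proof induction
    case (gen \<phi>)
    then show ?case by (rule F)
  next
    case (add \<phi>1 \<phi>2)
    then obtain \<psi>1 \<psi>2 where "\<psi>1 \<in> function_algebra F" "\<psi>2 \<in> function_algebra F"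
      and "\<forall>t\<in>S. (\<phi>1 has_real_derivative \<psi>1 t) (at t within S)"
      and "\<forall>t\<in>S. (\<phi>2 has_real_derivative \<psi>2 t) (at t within S)"
      by blast
    then show ?case
      by (intro bexI[of _ "\<lambda>x. \<psi>1 x + \<psi>2 x"])
         (auto intro!: derivative_eq_intros function_algebra.add)
  next
    case (mult \<phi>1 \<phi>2)
    then obtain \<psi>1 \<psi>2 where "\<psi>1 \<in> function_algebra F" "\<psi>2 \<in> function_algebra F"
      and "\<forall>t\<in>S. (\<phi>1 has_real_derivative \<psi>1 t) (at t within S)"
      and "\<forall>t\<in>S. (\<phi>2 has_real_derivative \<psi>2 t) (at t within S)"
      by blast
    with mult.hyps show ?case
      by (intro bexI[of _ "\<lambda>x. \<psi>1 x * \<phi>2 x + \<psi>2 x * \<phi>1 x"] function_algebra.add function_algebra.mult)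
         (auto intro!: DERIV_mult)
  qed
  \<comment> \<open>Agreement is claimed on \<open>S\<close> only, because \<open>deriv_on S\<close>
    has no controlled value elsewhere; derivatives within \<open>S\<close> do not see the
    difference.\<close>
  have iter: "\<exists>\<psi>\<in>function_algebra F. \<forall>t\<in>S. (deriv_on S ^^ n) f t = \<psi> t" for n
  proof (induction n)
    case 0
    with f show ?case by auto
  next
    case (Suc n)
    then obtain \<psi> where \<psi>: "\<psi> \<in> function_algebra F" "\<forall>t\<in>S. (deriv_on S ^^ n) f t = \<psi> t"
      by blast
    obtain \<xi> where \<xi>: "\<xi> \<in> function_algebra F"
      "\<forall>t\<in>S. (\<psi> has_real_derivative \<xi> t) (at t within S)"
      using step[OF \<psi>(1)] by blast
    have "((deriv_on S ^^ n) f has_real_derivative \<xi> t) (at t within S)" if "t \<in> S" for t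
      by (rule has_real_derivative_cong_on[OF bspec[OF \<xi>(2) that] \<psi>(2) that])
    then have "\<forall>t\<in>S. (deriv_on S ^^ Suc n) f t = \<xi> t"
      by (auto intro!: deriv_on_eqI nontriv)
    with \<xi>(1) show ?case by blast
  qed
  show ?thesis
    unfolding smooth_on_def
  proof (intro allI ballI)
    fix n t assume t: "t \<in> S"
    obtain \<psi> where \<psi>: "\<psi> \<in> function_algebra F" "\<forall>t\<in>S. (deriv_on S ^^ n) f t = \<psi> t"
      using iter by blast
    obtain \<xi> where \<xi>: "\<forall>t\<in>S. (\<psi> has_real_derivative \<xi> t) (at t within S)"
      using step[OF \<psi>(1)] by blast
    have "((deriv_on S ^^ n) f has_real_derivative \<xi> t) (at t within S)"
      by (rule has_real_derivative_cong_on[OF bspec[OF \<xi> t] \<psi>(2) t])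
    then show "(deriv_on S ^^ n) f differentiable at t within S"
      using real_differentiable_def by blast
  qed
qed

lemma smooth_on_deriv_on:
  assumes "smooth_on S f"
  shows "smooth_on S (deriv_on S f)"
proof -
  have "(deriv_on S ^^ n) (deriv_on S f) = (deriv_on S ^^ Suc n) f" for n
    by (simp add: funpow_swap1)
  with assms show ?thesis
    unfolding smooth_on_def by metis
qed

lemma smooth_on_has_real_derivative:
  assumes "smooth_on S f" "t \<in> S"
  shows "(f has_real_derivative deriv_on S f t) (at t within S)"
proof -
  have "((deriv_on S ^^ 0) f) differentiable (at t within S)"
    using assms unfolding smooth_on_def by blast
  then show ?thesis
    by (simp add: deriv_on_def has_real_derivative_iff_has_vector_derivative vector_derivative_works)
qed

lemma smooth_deriv_on_eq:
  assumes "smooth f"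
  shows "deriv_on UNIV f = deriv f"
  using DERIV_imp_deriv[OF smooth_on_has_real_derivative[OF assms]] by auto

lemma smooth_deriv: "smooth f \<Longrightarrow> smooth (deriv f)"
  using smooth_on_deriv_on smooth_deriv_on_eq by metis

lemma smooth_has_real_derivative: "smooth f \<Longrightarrow> (f has_real_derivative deriv f x) (at x)"
  using smooth_on_has_real_derivative[of UNIV f x] by (simp add: smooth_deriv_on_eq)

text \<open>Smooth functions are closed under \<open>deriv\<close>, so they can all serve as
  generators and only the additional functions in \<open>F\<close> need checking.\<close>

lemma smooth_function_algebra:
  assumes "\<And>\<phi>. \<phi> \<in> F \<Longrightarrow>
      \<exists>\<psi>\<in>function_algebra (Collect smooth \<union> F). \<forall>t. (\<phi> has_real_derivative \<psi> t) (at t)"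
    and "f \<in> function_algebra (Collect smooth \<union> F)"
  shows "smooth f"
proof (rule smooth_on_coinduct)
  show "f \<in> function_algebra (Collect smooth \<union> F)" by fact
  fix \<phi> assume "\<phi> \<in> Collect smooth \<union> F"
  then show "\<exists>\<psi>\<in>function_algebra (Collect smooth \<union> F). \<forall>t\<in>UNIV. (\<phi> has_real_derivative \<psi> t) (at t)"
  proof
    assume "\<phi> \<in> Collect smooth"
    then show ?thesis
      by (intro bexI[of _ "deriv \<phi>"])
         (auto intro: smooth_has_real_derivative smooth_deriv function_algebra.gen)
  qed (use assms(1) in auto)
qed auto

lemma smooth_add: "smooth f \<Longrightarrow> smooth g \<Longrightarrow> smooth (\<lambda>x. f x + g x)"
  by (rule smooth_function_algebra[of "{}"]) (auto intro: function_algebra.intros)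

lemma smooth_mult: "smooth f \<Longrightarrow> smooth g \<Longrightarrow> smooth (\<lambda>x. f x * g x)"
  by (rule smooth_function_algebra[of "{}"]) (auto intro: function_algebra.intros)

lemma smooth_poly: "smooth (poly p)"
proof (rule smooth_on_coinduct)
  fix \<phi> :: "real \<Rightarrow> real" assume "\<phi> \<in> range poly"
  then obtain q where "\<phi> = poly q" by blast
  then show "\<exists>\<psi>\<in>function_algebra (range poly). \<forall>t\<in>UNIV. (\<phi> has_real_derivative \<psi> t) (at t)"
    by (intro bexI[of _ "poly (pderiv q)"]) (auto intro: function_algebra.gen poly_DERIV)
qed (auto intro: function_algebra.gen)

lemma smooth_const: "smooth (\<lambda>x. c)"
proof -
  have "poly [:c:] = (\<lambda>x. c)" by auto
  then show ?thesis using smooth_poly[of "[:c:]"] by simp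
qed

text \<open>The derivative of \<open>1/f\<close> is \<open>- f' (1/f) (1/f)\<close>, a product of a
  smooth function with copies of the new generator.\<close>

lemma smooth_inverse:
  assumes f: "smooth f" and nz: "\<And>x. f x \<noteq> 0"
  shows "smooth (\<lambda>x. inverse (f x))"
proof (rule smooth_function_algebra[of "{\<lambda>x. inverse (f x)}"])
  let ?A = "function_algebra (Collect smooth \<union> {\<lambda>x. inverse (f x)})"
  fix \<phi> assume "\<phi> \<in> {\<lambda>x. inverse (f x)}"
  then have \<phi>: "\<phi> = (\<lambda>x. inverse (f x))" by simp
  have "smooth (\<lambda>x. - 1 * deriv f x)"
    by (intro smooth_mult smooth_const smooth_deriv f)
  then have mem: "(\<lambda>x. (- 1 * deriv f x) * (inverse (f x) * inverse (f x))) \<in> ?A"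
    by (intro function_algebra.mult function_algebra.gen) auto
  have der: "(\<phi> has_real_derivative (- 1 * deriv f t) * (inverse (f t) * inverse (f t))) (at t)" for t
    unfolding \<phi> using DERIV_inverse'[OF smooth_has_real_derivative[OF f] nz]
    by (simp add: algebra_simps)
  show "\<exists>\<psi>\<in>?A. \<forall>t. (\<phi> has_real_derivative \<psi> t) (at t)"
    by (rule bexI[OF _ mem]) (intro allI der)
qed (auto intro: function_algebra.gen)

text \<open>The new generator \<open>exp G\<close> reproduces itself up to the smooth factor
  \<open>h\<close>, so smoothness of \<open>G\<close> need not be established first.\<close>

lemma smooth_exp_antiderivative:
  assumes h: "smooth h" and G: "\<And>x. (G has_real_derivative h x) (at x)"
  shows "smooth (\<lambda>x. exp (G x))"
proof (rule smooth_function_algebra[of "{\<lambda>x. exp (G x)}"])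
  let ?A = "function_algebra (Collect smooth \<union> {\<lambda>x. exp (G x)})"
  fix \<phi> assume "\<phi> \<in> {\<lambda>x. exp (G x)}"
  then have \<phi>: "\<phi> = (\<lambda>x. exp (G x))" by simp
  have mem: "(\<lambda>x. exp (G x) * h x) \<in> ?A"
    using h by (intro function_algebra.mult function_algebra.gen) auto
  have der: "(\<phi> has_real_derivative exp (G t) * h t) (at t)" for t
    unfolding \<phi> by (auto intro!: derivative_eq_intros G)
  show "\<exists>\<psi>\<in>?A. \<forall>t. (\<phi> has_real_derivative \<psi> t) (at t)"
    by (rule bexI[OF _ mem]) (intro allI der)
qed (auto intro: function_algebra.gen)

lemma continuous_antiderivative:
  fixes h :: "real \<Rightarrow> real"
  assumes "\<And>x. isCont h x"
  obtains G where "\<And>x. (G has_real_derivative h x) (at x)"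
  using einterval_antiderivative[of "-\<infinity>" \<infinity> h] assms
  by (auto simp: has_real_derivative_iff_has_vector_derivative)

section \<open>The metric \<open>p\<^sup>2 dx\<^sup>2\<close>\<close>

text \<open>By the Leibniz rule, every connection on the line has this form on smooth fields, with
  \<open>\<Gamma>\<close> its Christoffel symbol.\<close>

definition line_connection :: "(real \<Rightarrow> real) \<Rightarrow> connection" where
  "line_connection \<Gamma> X Y = (\<lambda>x. X x * deriv Y x + \<Gamma> x * X x * Y x)"

text \<open>The term with \<open>\<Gamma>\<close> is symmetric in \<open>X\<close> and
  \<open>Y\<close>, so it cancels in the torsion.\<close>

lemma is_connection_line_connection:
  assumes "smooth \<Gamma>"
  shows "is_connection (line_connection \<Gamma>)"
proof -
  have lin: "deriv (\<lambda>x. a * Y x + b * Z x) x = a * deriv Y x + b * deriv Z x"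
    if "smooth Y" "smooth Z" for a b Y Z x
    by (rule DERIV_imp_deriv)
       (auto intro!: derivative_eq_intros smooth_has_real_derivative that)
  have leib: "deriv (\<lambda>x. \<phi> x * Y x) x = deriv \<phi> x * Y x + deriv Y x * \<phi> x"
    if "smooth \<phi>" "smooth Y" for \<phi> Y x
    by (rule DERIV_imp_deriv) (intro DERIV_mult smooth_has_real_derivative that)
  show ?thesis
    unfolding is_connection_def affine_connection_def torsion_free_def line_connection_def
      dir_deriv_def lie_bracket_def
    by (auto simp: lin leib fun_eq_iff algebra_simps
        intro!: smooth_add smooth_mult smooth_deriv assms)
qed

lemma christoffel_line_connection: "christoffel (line_connection \<Gamma>) = \<Gamma>"
  by (simp add: christoffel_def line_connection_def)

lemma riemannian_metric_square:
  assumes "smooth p" "\<And>x. p x \<noteq> 0"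
  shows "riemannian_metric (\<lambda>x v w. (p x)\<^sup>2 * v * w)"
proof -
  have "bilinear (\<lambda>v w. (p x)\<^sup>2 * v * w)" for x
    by (auto simp: bilinear_def linear_iff algebra_simps)
  moreover have "smooth (\<lambda>x. (p x)\<^sup>2 * X x * Y x)" if "smooth X" "smooth Y" for X Y
    unfolding power2_eq_square by (intro smooth_mult assms that)
  moreover have "(p x)\<^sup>2 * v * v > 0" if "v \<noteq> 0" for x v
    using assms(2)[of x] that by (simp add: mult.assoc flip: power2_eq_square)
  ultimately show ?thesis
    unfolding riemannian_metric_def by auto
qed

text \<open>In dimension one the Levi-Civita symbol of \<open>G dx\<^sup>2\<close> is
  \<open>G'/(2 G)\<close>; for \<open>G = p\<^sup>2\<close> this is \<open>p'/p\<close>.\<close>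

lemma levi_civita_square:
  assumes p: "smooth p" and nz: "\<And>x. p x \<noteq> 0"
  shows "levi_civita (\<lambda>x v w. (p x)\<^sup>2 * v * w) (line_connection (\<lambda>x. deriv p x * inverse (p x)))"
proof -
  have "deriv (\<lambda>x. (p x)\<^sup>2 * Y x * Z x) x =
      2 * p x * deriv p x * Y x * Z x + (p x)\<^sup>2 * deriv Y x * Z x + (p x)\<^sup>2 * Y x * deriv Z x"
    if "smooth Y" "smooth Z" for Y Z x
    by (rule DERIV_imp_deriv)
       (auto intro!: derivative_eq_intros smooth_has_real_derivative that p simp: algebra_simps)
  then have "metric_compatible (\<lambda>x v w. (p x)\<^sup>2 * v * w)
      (line_connection (\<lambda>x. deriv p x * inverse (p x)))"
    using nz unfolding metric_compatible_def dir_deriv_def line_connection_def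
    by (auto simp: fun_eq_iff field_simps power2_eq_square)
  with assms show ?thesis
    unfolding levi_civita_def
    by (intro conjI is_connection_line_connection smooth_mult smooth_deriv smooth_inverse)
qed

section \<open>Convexity along the geodesics of \<open>p\<^sup>2 dx\<^sup>2\<close>\<close>

lemma at_within_unit_interval: "t \<in> {0..1} \<Longrightarrow> at t within {0..1::real} \<noteq> bot"
  by (simp add: trivial_limit_within islimpt_Icc)

text \<open>By the mean value theorem the slopes of the chords on either side of an intermediate
  point are values of \<open>h'\<close>, hence ordered.\<close>

lemma convex_on_Icc_if_deriv_mono:
  fixes h :: "real \<Rightarrow> real"
  assumes cont: "continuous_on {a..b} h"
    and der: "\<And>t. a < t \<Longrightarrow> t < b \<Longrightarrow> (h has_real_derivative h' t) (at t)"
    and mono: "\<And>s t. a < s \<Longrightarrow> s \<le> t \<Longrightarrow> t < b \<Longrightarrow> h' s \<le> h' t"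
  shows "convex_on {a..b} h"
proof (rule convex_on_linorderI)
  fix t x y :: real
  assume t: "0 < t" "t < 1" and xy: "x \<in> {a..b}" "y \<in> {a..b}" "x < y"
  define z where "z = (1 - t) * x + t * y"
  have zx: "z - x = t * (y - x)"
    by (simp add: z_def algebra_simps)
  have yz: "y - z = (1 - t) * (y - x)"
    by (simp add: z_def algebra_simps)
  have "0 < t * (y - x)" "0 < (1 - t) * (y - x)"
    using t xy by simp_all
  then have z: "x < z" "z < y"
    unfolding zx[symmetric] yz[symmetric] by simp_all
  have mvt: "\<exists>s>c. s < d \<and> h d - h c = (d - c) * h' s" if "a \<le> c" "c < d" "d \<le> b" for c d
  proof (rule mvt[of c d h "\<lambda>s. (*) (h' s)"])
    show "continuous_on {c..d} h"
      using cont that by (auto intro: continuous_on_subset)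
  qed (use der that in \<open>auto simp: has_field_derivative_def\<close>)
  obtain s1 where s1: "x < s1" "s1 < z" "h z - h x = (z - x) * h' s1"
    using mvt[of x z] xy z by auto
  obtain s2 where s2: "z < s2" "s2 < y" "h y - h z = (y - z) * h' s2"
    using mvt[of z y] xy z by auto
  have "h' s1 \<le> h' s2"
    using mono s1 s2 xy by simp
  \<comment> \<open>The common factor equals both \<open>(1 - t) * (z - x)\<close> and
    \<open>t * (y - z)\<close>, which turns the slopes back into increments of
    \<open>h\<close>.\<close>
  then have "t * (1 - t) * (y - x) * h' s1 \<le> t * (1 - t) * (y - x) * h' s2"
    using t xy by (intro mult_left_mono) auto
  then have "(1 - t) * (h z - h x) \<le> t * (h y - h z)"
    using s1(3) s2(3) zx yz by (simp add: mult_ac)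
  then show "h ((1 - t) *\<^sub>R x + t *\<^sub>R y) \<le> (1 - t) * h x + t * h y"
    by (simp add: z_def algebra_simps)
qed auto


text \<open>Along a geodesic \<open>p(\<gamma>) \<gamma>'\<close> is a constant \<open>c\<close>, so
  \<open>(f(\<gamma>))' = c q(\<gamma>)\<close>. The derivative of this is
  \<open>q'(\<gamma>) p(\<gamma>) (\<gamma>')\<^sup>2\<close>, which is nonnegative.\<close>

lemma g_convex_line_connection:
  assumes f: "\<And>x. (f has_real_derivative q x * p x) (at x)"
    and p: "\<And>x. (p has_real_derivative p' x) (at x)"
    and q: "\<And>x. (q has_real_derivative q' x) (at x)"
    and nz: "\<And>x. p x \<noteq> 0" and nonneg: "\<And>x. q' x * p x \<ge> 0"
  shows "g_convex (line_connection (\<lambda>x. p' x * inverse (p x))) f"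
  unfolding g_convex_def
proof (intro allI impI)
  fix \<gamma> assume geo: "geodesic (line_connection (\<lambda>x. p' x * inverse (p x))) \<gamma>"
  define v where "v = deriv_on {0..1} \<gamma>"
  define w where "w = deriv_on {0..1} v"
  have smooth: "smooth_on {0..1} \<gamma>"
    using geo by (simp add: geodesic_def)
  have \<gamma>: "(\<gamma> has_real_derivative v t) (at t within {0..1})" if "t \<in> {0..1}" for t
    unfolding v_def using smooth that by (rule smooth_on_has_real_derivative)
  have v: "(v has_real_derivative w t) (at t within {0..1})" if "t \<in> {0..1}" for t
    unfolding w_def using smooth_on_deriv_on[OF smooth] that
    by (auto simp: v_def intro: smooth_on_has_real_derivative)
  have w: "p (\<gamma> t) * w t = - (p' (\<gamma> t) * v t * v t)" if "t \<in> {0..1}" for t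
  proof -
    have "w t + p' (\<gamma> t) * inverse (p (\<gamma> t)) * v t * v t = 0"
      using geo that
      by (simp add: geodesic_def cov_deriv_along_def christoffel_line_connection v_def w_def)
    then show ?thesis
      using nz[of "\<gamma> t"] by (simp add: field_simps)
  qed
  have comp: "((\<lambda>t. k (\<gamma> t)) has_real_derivative d * v t) (at t within {0..1})"
    if "t \<in> {0..1}" "(k has_real_derivative d) (at (\<gamma> t))" for k d t
    using that(2) \<gamma>[OF that(1)] by (rule DERIV_chain2)
  \<comment> \<open>The first integral of the geodesic equation: the signed speed in the metric
    \<open>p\<^sup>2 dx\<^sup>2\<close>.\<close>
  have "\<exists>c. \<forall>t\<in>{0..1}. p (\<gamma> t) * v t = c"
  proof (intro has_field_derivative_zero_constant)
    fix t :: real assume t: "t \<in> {0..1}"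
    show "((\<lambda>t. p (\<gamma> t) * v t) has_real_derivative 0) (at t within {0..1})"
      using DERIV_mult[OF comp[OF t p] v[OF t]] w[OF t] by (simp add: algebra_simps)
  qed auto
  then obtain c where c: "\<And>t. t \<in> {0..1} \<Longrightarrow> p (\<gamma> t) * v t = c"
    by blast
  have c_at: "at t within {0..1} = at t" if "0 < t" "t < 1" for t :: real
    using that by (rule at_within_Icc_at)
  have fd: "((f \<circ> \<gamma>) has_real_derivative c * q (\<gamma> t)) (at t within {0..1})" if "t \<in> {0..1}" for t
    unfolding c[OF that, symmetric] using comp[OF that f] by (simp add: o_def mult_ac)
  show "convex_on {0..1} (f \<circ> \<gamma>)"
  proof (rule convex_on_Icc_if_deriv_mono)
    show "continuous_on {0..1} (f \<circ> \<gamma>)"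
      using fd by (rule DERIV_continuous_on)
    show "((f \<circ> \<gamma>) has_real_derivative c * q (\<gamma> t)) (at t)" if "0 < t" "t < 1" for t
      using fd[of t] c_at that by simp
    show "c * q (\<gamma> s) \<le> c * q (\<gamma> t)" if st: "0 < s" "s \<le> t" "t < 1" for s t
    proof (rule DERIV_nonneg_imp_nondecreasing[OF \<open>s \<le> t\<close>], intro exI conjI)
      fix x assume "s \<le> x" "x \<le> t"
      with st have x: "0 < x" "x < 1" "x \<in> {0..1}" by auto
      show "((\<lambda>x. c * q (\<gamma> x)) has_real_derivative c * (q' (\<gamma> x) * v x)) (at x)"
        using DERIV_cmult[OF comp[OF x(3) q]] c_at[OF x(1,2)] by simp
      have eq: "c * (q' (\<gamma> x) * v x) = (q' (\<gamma> x) * p (\<gamma> x)) * (v x)\<^sup>2"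
        by (simp add: c[OF x(3), symmetric] power2_eq_square)
      show "0 \<le> c * (q' (\<gamma> x) * v x)"
        unfolding eq using nonneg[of "\<gamma> x"] by (rule mult_nonneg_nonneg) simp
    qed
  qed
qed

lemma g_convex_some_metric:
  fixes f p q :: "real poly"
  assumes "pderiv f = q * p" and nz: "\<And>x. poly p x \<noteq> 0" and "\<And>x. poly (pderiv q) x * poly p x \<ge> 0"
  shows "\<exists>g D. riemannian_metric g \<and> levi_civita g D \<and> g_convex D (poly f)"
proof -
  have "deriv (poly p) = poly (pderiv p)"
    by (auto intro: DERIV_imp_deriv poly_DERIV)
  moreover have "g_convex (line_connection (\<lambda>x. poly (pderiv p) x * inverse (poly p x))) (poly f)"
    by (rule g_convex_line_connection[where q = "poly q" and q' = "poly (pderiv q)"])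
       (use assms poly_DERIV[of f] in \<open>auto intro: poly_DERIV\<close>)
  ultimately show ?thesis
    using riemannian_metric_square[OF smooth_poly nz] levi_civita_square[OF smooth_poly nz]
    by (intro exI conjI) (assumption | simp only:)+
qed

section \<open>Geodesics between two points\<close>

text \<open>\<open>\<Phi>\<close> is an affine coordinate, in which geodesics are uniformly
  parametrised segments; \<open>\<gamma>\<close> is the preimage of the segment from
  \<open>\<Phi> a\<close> to \<open>\<Phi> b\<close>. The range of \<open>\<Phi>\<close> may be a
  proper part of the line, but it is an interval and so contains that segment.\<close>

lemma geodesic_between:
  assumes "is_connection D"
  obtains \<gamma> where "geodesic D \<gamma>" "\<gamma> 0 = a" "\<gamma> 1 = b"
proof -
  let ?\<Gamma> = "christoffel D"
  have smooth_\<Gamma>: "smooth ?\<Gamma>"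
    using assms smooth_const[of 1]
    unfolding is_connection_def affine_connection_def christoffel_def by blast
  have "isCont ?\<Gamma> x" for x
    using smooth_has_real_derivative[OF smooth_\<Gamma>] by (rule DERIV_isCont)
  then obtain G where G: "\<And>x. (G has_real_derivative ?\<Gamma> x) (at x)"
    using continuous_antiderivative by blast
  have "isCont (\<lambda>x. exp (G x)) x" for x
    using DERIV_isCont[OF G] by (intro continuous_intros)
  then obtain \<Phi> where \<Phi>: "\<And>x. (\<Phi> has_real_derivative exp (G x)) (at x)"
    using continuous_antiderivative by blast
  have cont: "isCont \<Phi> x" for x
    using \<Phi> by (rule DERIV_isCont)
  have less: "\<Phi> x < \<Phi> y" if "x < y" for x y
    using that \<Phi> exp_gt_zero by (intro DERIV_pos_imp_increasing[of x y \<Phi>]) blast+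
  then have "inj \<Phi>"
    by (metis injI less_irrefl linorder_neqE)
  define \<Psi> where "\<Psi> = inv \<Phi>"
  have \<Psi>\<Phi>: "\<Psi> (\<Phi> x) = x" for x
    using \<open>inj \<Phi>\<close> by (simp add: \<Psi>_def)
  have range: "y \<in> range \<Phi>" if "\<Phi> x \<le> y" "y \<le> \<Phi> x'" for x x' y
  proof -
    have "connected (range \<Phi>)"
      using cont by (intro connected_continuous_image continuous_at_imp_continuous_on) auto
    then show ?thesis
      using that unfolding connected_iff_interval by blast
  qed
  have \<Psi>: "(\<Psi> has_real_derivative exp (- G (\<Psi> y))) (at y)" if "y \<in> range \<Phi>" for y
  proof -
    obtain x where y: "y = \<Phi> x" using \<open>y \<in> range \<Phi>\<close> by blast
    have "isCont \<Psi> (\<Phi> x)"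
      by (rule isCont_inverse_function[of 1]) (auto simp: \<Psi>\<Phi> cont)
    \<comment> \<open>The inverse function rule wants an open interval around \<open>y\<close> on
      which \<open>\<Psi>\<close> is a right inverse; the images of \<open>x - 1\<close> and
      \<open>x + 1\<close> bound one.\<close>
    moreover have "\<Phi> (\<Psi> z) = z" if "\<Phi> (x - 1) < z" "z < \<Phi> (x + 1)" for z
      using range[of "x - 1" z "x + 1"] that \<Psi>\<Phi> by auto
    moreover have "\<Phi> (x - 1) < y" "y < \<Phi> (x + 1)"
      using less by (auto simp: y)
    ultimately have "(\<Psi> has_real_derivative inverse (exp (G (\<Psi> y)))) (at y)"
      using \<Phi>[of "\<Psi> y"]
      by (intro DERIV_inverse_function[of \<Phi> _ \<Psi> y "\<Phi> (x - 1)" "\<Phi> (x + 1)"]) (auto simp: y)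
    then show ?thesis
      by (simp add: exp_minus)
  qed
  define c where "c = \<Phi> b - \<Phi> a"
  define \<gamma> where "\<gamma> = (\<lambda>t. \<Psi> (\<Phi> a + t * c))"
  \<comment> \<open>Differentiating \<open>\<Phi>(\<gamma> t) = \<Phi> a + t c\<close> gives the
    autonomous equation \<open>\<gamma>' = e(\<gamma>)\<close>. Since
    \<open>e' = - \<Gamma> e\<close>, it implies the geodesic equation.\<close>
  define e where "e x = c * exp (- G x)" for x
  have e_deriv: "(e has_real_derivative - ?\<Gamma> x * e x) (at x)" for x
    unfolding e_def by (auto intro!: derivative_eq_intros G)
  have smooth_e: "smooth e"
    unfolding e_def
    by (intro smooth_mult smooth_const smooth_exp_antiderivative[of "\<lambda>x. - 1 * ?\<Gamma> x"] smooth_\<Gamma>)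
       (auto intro!: derivative_eq_intros G)
  have \<gamma>_deriv: "(\<gamma> has_real_derivative e (\<gamma> t)) (at t within {0..1})" if "t \<in> {0..1}" for t
  proof -
    have "\<Phi> a + t * c = (1 - t) * \<Phi> a + t * \<Phi> b"
      by (simp add: c_def algebra_simps)
    moreover have "\<Phi> x \<le> \<Phi> y" if "x \<le> y" for x y
      using less[of x y] that by (cases "x = y") auto
    \<comment> \<open>The lower bounds are negated so that \<open>convex_bound_le\<close> serves for
      both sides of the segment.\<close>
    then have "\<Phi> a \<le> \<Phi> (max a b)" "\<Phi> b \<le> \<Phi> (max a b)" "- \<Phi> a \<le> - \<Phi> (min a b)" "- \<Phi> b \<le> - \<Phi> (min a b)"
      by simp_all
    then have "(1 - t) * \<Phi> a + t * \<Phi> b \<le> \<Phi> (max a b)"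
      "(1 - t) * (- \<Phi> a) + t * (- \<Phi> b) \<le> - \<Phi> (min a b)"
      using that by (intro convex_bound_le; simp)+
    ultimately have "\<Phi> (min a b) \<le> \<Phi> a + t * c" "\<Phi> a + t * c \<le> \<Phi> (max a b)"
      by simp_all
    then have "\<Phi> a + t * c \<in> range \<Phi>"
      by (rule range)
    moreover have "((\<lambda>t. \<Phi> a + t * c) has_real_derivative c) (at t within {0..1})"
      by (auto intro!: derivative_eq_intros)
    ultimately have "((\<lambda>t. \<Psi> (\<Phi> a + t * c)) has_real_derivative
        exp (- G (\<Psi> (\<Phi> a + t * c))) * c) (at t within {0..1})"
      by (intro DERIV_chain2[of \<Psi>] \<Psi>)
    then show ?thesis
      by (simp add: \<gamma>_def e_def mult.commute)
  qed
  have comp: "((\<lambda>t. \<phi> (\<gamma> t)) has_real_derivative d * e (\<gamma> t)) (at t within {0..1})"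
    if "t \<in> {0..1}" "(\<phi> has_real_derivative d) (at (\<gamma> t))" for \<phi> d t
    using that(2) \<gamma>_deriv[OF that(1)] by (rule DERIV_chain2)
  have smooth_\<gamma>: "smooth_on {0..1} \<gamma>"
  proof (rule smooth_on_coinduct)
    \<comment> \<open>Composites with \<open>\<gamma>\<close> are closed under derivatives:
      \<open>\<phi>(\<gamma>)\<close> has derivative \<open>(\<phi>' e)(\<gamma>)\<close>, and
      \<open>\<phi>' e\<close> is smooth.\<close>
    let ?F = "{\<lambda>t. \<phi> (\<gamma> t) | \<phi>. smooth \<phi>}"
    have "poly [:0, 1:] = (\<lambda>x. x :: real)" by auto
    then have "smooth (\<lambda>x. x)"
      using smooth_poly[of "[:0, 1:]"] by simp
    then show "\<gamma> \<in> function_algebra ?F"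
      by (intro function_algebra.gen CollectI exI[of _ "\<lambda>x. x"]) simp
    fix \<eta> assume "\<eta> \<in> ?F"
    then obtain \<phi> where \<eta>: "\<eta> = (\<lambda>t. \<phi> (\<gamma> t))" and \<phi>: "smooth \<phi>" by blast
    have mem: "(\<lambda>t. deriv \<phi> (\<gamma> t) * e (\<gamma> t)) \<in> function_algebra ?F"
      using smooth_mult[OF smooth_deriv[OF \<phi>] smooth_e]
      by (intro function_algebra.gen CollectI exI[of _ "\<lambda>x. deriv \<phi> x * e x"]) simp
    show "\<exists>\<psi>\<in>function_algebra ?F. \<forall>t\<in>{0..1}. (\<eta> has_real_derivative \<psi> t) (at t within {0..1})"
      unfolding \<eta>
      by (rule bexI[OF _ mem]) (intro ballI comp smooth_has_real_derivative \<phi>)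
  qed (rule at_within_unit_interval)
  have v: "deriv_on {0..1} \<gamma> t = e (\<gamma> t)" if "t \<in> {0..1}" for t
    using that by (intro deriv_on_eqI \<gamma>_deriv at_within_unit_interval)
  have w: "deriv_on {0..1} (deriv_on {0..1} \<gamma>) t = - ?\<Gamma> (\<gamma> t) * e (\<gamma> t) * e (\<gamma> t)"
    if "t \<in> {0..1}" for t
  proof (intro deriv_on_eqI at_within_unit_interval that)
    show "(deriv_on {0..1} \<gamma> has_real_derivative - ?\<Gamma> (\<gamma> t) * e (\<gamma> t) * e (\<gamma> t)) (at t within {0..1})"
      using v by (intro has_real_derivative_cong_on[OF comp[OF that e_deriv] _ that]) simp
  qed
  have "geodesic D \<gamma>"
    unfolding geodesic_def cov_deriv_along_def using smooth_\<gamma> by (simp add: v w)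
  moreover have "\<gamma> 0 = a" "\<gamma> 1 = b"
    by (simp_all add: \<gamma>_def c_def \<Psi>\<Phi>)
  ultimately show ?thesis by (rule that)
qed

section \<open>Critical points and upper bounds of g-convex functions\<close>

lemma geodesic_has_derivative:
  assumes "geodesic D \<gamma>" "t \<in> {0..1}"
  shows "(\<gamma> has_real_derivative deriv_on {0..1} \<gamma> t) (at t within {0..1})"
  using assms by (auto simp: geodesic_def intro: smooth_on_has_real_derivative)

text \<open>Convexity bounds every difference quotient at \<open>0\<close> by
  \<open>h 1 - h 0\<close>, and these quotients tend to \<open>0\<close>.\<close>

lemma convex_on_Icc_critical_left_endpoint:
  fixes h :: "real \<Rightarrow> real"
  assumes "convex_on {0..1} h" "(h has_real_derivative 0) (at 0 within {0..1})"
  shows "h 0 \<le> h 1"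
proof -
  have "((\<lambda>t. (h t - h 0) / (t - 0)) \<longlongrightarrow> 0) (at 0 within {0..1})"
    using assms(2) unfolding has_field_derivative_iff .
  moreover have "\<forall>\<^sub>F t in at 0 within {0..1}. (h t - h 0) / (t - 0) \<le> h 1 - h 0"
    unfolding eventually_at
  proof (intro exI[of _ 1] conjI ballI impI)
    fix t :: real assume "t \<in> {0..1}" "t \<noteq> 0 \<and> dist t 0 < 1"
    then have t: "0 < t" "t \<le> 1" by auto
    then have "h t \<le> (1 - t) * h 0 + t * h 1"
      using convex_onD[OF assms(1), of t 0 1] by simp
    with t show "(h t - h 0) / (t - 0) \<le> h 1 - h 0"
      by (simp add: field_simps)
  qed simp
  ultimately have "0 \<le> h 1 - h 0"
    by (rule tendsto_upperbound) (simp add: at_within_unit_interval)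
  then show ?thesis by simp
qed

text \<open>Along a geodesic from \<open>u\<close> to \<open>y\<close> the chain rule gives
  \<open>f\<close> derivative zero at the start.\<close>

lemma g_convex_critical_point_is_minimum:
  assumes "is_connection D" "g_convex D f" "(f has_real_derivative 0) (at u)"
  shows "f u \<le> f y"
proof -
  obtain \<gamma> where \<gamma>: "geodesic D \<gamma>" "\<gamma> 0 = u" "\<gamma> 1 = y"
    using geodesic_between[OF assms(1)] .
  have "((\<lambda>t. f (\<gamma> t)) has_real_derivative 0 * deriv_on {0..1} \<gamma> 0) (at 0 within {0..1})"
    using assms(3) \<gamma>(2) geodesic_has_derivative[OF \<gamma>(1), of 0]
    by (intro DERIV_chain2[of f]) auto
  then have "(f \<circ> \<gamma>) 0 \<le> (f \<circ> \<gamma>) 1"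
    using assms(2) \<gamma>(1)
    by (intro convex_on_Icc_critical_left_endpoint) (auto simp: g_convex_def o_def)
  with \<gamma> show ?thesis by simp
qed

text \<open>A geodesic from \<open>a\<close> to \<open>b\<close> passes through \<open>x\<close> by
  the intermediate value theorem, and convexity bounds \<open>f\<close> there by its end
  values.\<close>

lemma g_convex_le_max:
  assumes "is_connection D" "g_convex D f" "a \<le> x" "x \<le> b"
  shows "f x \<le> max (f a) (f b)"
proof -
  obtain \<gamma> where \<gamma>: "geodesic D \<gamma>" "\<gamma> 0 = a" "\<gamma> 1 = b"
    using geodesic_between[OF assms(1)] .
  have "continuous_on {0..1} \<gamma>"
    using geodesic_has_derivative[OF \<gamma>(1)] by (rule DERIV_continuous_on)
  then obtain t where t: "0 \<le> t" "t \<le> 1" "\<gamma> t = x"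
    using IVT'[of \<gamma> 0 x 1] assms \<gamma> by auto
  have "convex_on {0..1} (f \<circ> \<gamma>)"
    using assms(2) \<gamma>(1) by (simp add: g_convex_def)
  from convex_onD[OF this, of t 0 1] have "f x \<le> (1 - t) * f a + t * f b"
    using t \<gamma> by simp
  also have "\<dots> \<le> max (f a) (f b)"
    using t by (intro convex_bound_le) auto
  finally show ?thesis .
qed

section \<open>Sign of the derivative of a polynomial\<close>

text \<open>Both points are global minima with a common value, and \<open>g_convex_le_max\<close>
  forces that value on all of \<open>{u..v}\<close>. A non-constant polynomial takes it only
  finitely often.\<close>

lemma g_convex_poly_critical_point_unique:
  fixes f :: "real poly"
  assumes D: "is_connection D" "g_convex D (poly f)" and "degree f \<noteq> 0"
    and crit: "poly (pderiv f) u = 0" "poly (pderiv f) v = 0"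
  shows "u = v"
  using crit
proof (induction u v rule: linorder_wlog)
  case (le u v)
  have min: "poly f w \<le> poly f x" if "poly (pderiv f) w = 0" for w x
    using g_convex_critical_point_is_minimum[OF D] poly_DERIV[of f w] that by simp
  have "poly f u = poly f v"
    by (intro antisym min le)
  then have const: "poly f x = poly f u" if "x \<in> {u..v}" for x
    using g_convex_le_max[OF D, of u x v] min[of u x] le that by simp
  have "{u..v} \<subseteq> {x. poly (f - [:poly f u:]) x = 0}"
  proof
    fix x assume "x \<in> {u..v}"
    from const[OF this] show "x \<in> {x. poly (f - [:poly f u:]) x = 0}"
      by simp
  qed
  moreover have "f - [:poly f u:] \<noteq> 0"
    using \<open>degree f \<noteq> 0\<close> by (metis degree_pCons_0 eq_iff_diff_eq_0)
  ultimately have "finite {u..v}"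
    by (rule finite_subset[OF _ poly_roots_finite])
  then have "\<not> u < v"
    using infinite_Icc by blast
  with le(1) show ?case by simp
qed simp

lemma poly_constant_sign:
  fixes p :: "real poly"
  assumes "\<And>x. poly p x \<noteq> 0" "poly p a > 0"
  shows "poly p x > 0"
proof (rule ccontr)
  assume "\<not> poly p x > 0"
  then have "poly p x < 0"
    using assms(1)[of x] by simp
  moreover from this have "a \<noteq> x"
    using assms(2) by auto
  ultimately show False
    using poly_IVT_neg[of a x p] poly_IVT_pos[of x a p] assms by (cases "a < x") auto
qed

text \<open>Splitting off the full power of the root \<open>u\<close> leaves a cofactor
  \<open>p\<close> without roots, hence of constant sign. Minimality of \<open>f\<close> at
  \<open>u\<close> fixes that sign by a point to the right of \<open>u\<close>, and then the parity
  of the exponent by a point to the left.\<close>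

lemma unique_critical_minimum_factorisation:
  fixes f :: "real poly"
  assumes crit: "\<And>x. poly (pderiv f) x = 0 \<longleftrightarrow> x = u" and min: "\<And>x. poly f u \<le> poly f x"
  shows "\<exists>r p. r \<ge> 1 \<and> (\<forall>x. poly p x > 0) \<and> pderiv f = [:- u, 1:] ^ (2 * r - 1) * p"
proof -
  have nz: "pderiv f \<noteq> 0"
    using crit[of "u + 1"] by auto
  obtain p where p: "pderiv f = [:- u, 1:] ^ order u (pderiv f) * p" "\<not> [:- u, 1:] dvd p"
    using order_decomp[OF nz] by blast
  define k where "k = order u (pderiv f)"
  have fp: "poly (pderiv f) x = (x - u) ^ k * poly p x" for x
    by (subst p(1)) (simp add: k_def)
  have "k \<noteq> 0"
    using crit[of u] nz by (simp add: k_def order_root)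
  have no_root: "poly p x \<noteq> 0" for x
    using p(2) crit[of x] fp[of x] by (cases "x = u") (auto simp: poly_eq_0_iff_dvd)
  obtain x where x: "u < x" "poly f (u + 1) - poly f u = (u + 1 - u) * poly (pderiv f) x"
    using poly_MVT[of u "u + 1" f] by auto
  then have "(x - u) ^ k * poly p x \<ge> 0"
    using min[of "u + 1"] by (simp add: fp)
  moreover have "(x - u) ^ k > 0"
    using x(1) by simp
  ultimately have "poly p x \<ge> 0"
    by (simp add: zero_le_mult_iff)
  with no_root[of x] have "poly p x > 0"
    by simp
  then have pos: "poly p y > 0" for y
    by (rule poly_constant_sign[OF no_root])
  obtain y where y: "u - 1 < y" "y < u" "poly f u - poly f (u - 1) = (u - (u - 1)) * poly (pderiv f) y"
    using poly_MVT[of "u - 1" u f] by auto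
  then have "(y - u) ^ k * poly p y \<le> 0"
    using min[of "u - 1"] by (simp add: fp)
  then have "(y - u) ^ k \<le> 0"
    using pos[of y] by (simp add: mult_le_0_iff)
  have "odd k"
  proof
    assume "even k"
    then have "(y - u) ^ k > 0"
      using y by (simp add: zero_less_power_eq)
    with \<open>(y - u) ^ k \<le> 0\<close> show False by simp
  qed
  \<comment> \<open>An odd \<open>k\<close> is \<open>2 * r + 1\<close>; the shift to
    \<open>r + 1\<close> gives the required form with a witness that is at least
    \<open>1\<close>.\<close>
  then obtain r where "k = 2 * (r + 1) - 1"
    by (auto elim!: oddE)
  then show ?thesis
    using p(1) pos by (intro exI[of _ "r + 1"] exI[of _ p]) (simp add: k_def)
qed

theorem theorem5p5:
  fixes f :: "real poly"
  assumes "degree f \<noteq> 0"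
  shows "((\<exists>D. is_connection D \<and> g_convex D (poly f)) \<longleftrightarrow>
           (\<exists>g D. riemannian_metric g \<and> levi_civita g D \<and> g_convex D (poly f))) \<and>
         ((\<exists>g D. riemannian_metric g \<and> levi_civita g D \<and> g_convex D (poly f)) \<longleftrightarrow>
           (\<not> (\<exists>x. poly (pderiv f) x = 0)) \<or>
           (\<exists>(u::real) (r::nat) (p::real poly). r \<ge> 1 \<and> (\<forall>x. poly p x > 0) \<and>
              pderiv f = [:- u, 1:] ^ (2 * r - 1) * p))"
    (is "(?a \<longleftrightarrow> ?b) \<and> (?b \<longleftrightarrow> ?c1 \<or> ?c2)")
proof -
  have "?c1 \<or> ?c2" if ?a
  proof (rule disjCI)
    assume "\<not> ?c2"
    obtain D where D: "is_connection D" "g_convex D (poly f)"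
      using \<open>?a\<close> by blast
    show ?c1
    proof
      assume "\<exists>x. poly (pderiv f) x = 0"
      then obtain u where u: "poly (pderiv f) u = 0" by blast
      have "poly (pderiv f) x = 0 \<longleftrightarrow> x = u" for x
        using g_convex_poly_critical_point_unique[OF D assms _ u] u by blast
      moreover have "poly f u \<le> poly f x" for x
        using g_convex_critical_point_is_minimum[OF D] poly_DERIV[of f u] u by simp
      ultimately show False
        using unique_critical_minimum_factorisation[of f u] \<open>\<not> ?c2\<close> by blast
    qed
  qed
  moreover have ?b if "?c1 \<or> ?c2"
    using that
  proof
    assume ?c1
    then show ?b
      \<comment> \<open>With \<open>q = 1\<close> the derivative of \<open>q\<close> vanishes, so
        the sign condition holds even where \<open>f'\<close> is negative.\<close>
      by (intro g_convex_some_metric[of f 1 "pderiv f"]) auto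
  next
    assume ?c2
    then obtain u r and p :: "real poly" where p: "r \<ge> 1" "\<And>x. poly p x > 0"
      "pderiv f = [:- u, 1:] ^ (2 * r - 1) * p"
      by blast
    show ?b
    proof (rule g_convex_some_metric[OF p(3)])
      fix x
      show "poly p x \<noteq> 0"
        using p(2)[of x] by simp
      \<comment> \<open>The derivative of an odd power carries an even power, which is nonnegative.
        The hypothesis \<open>r \<ge> 1\<close> keeps the subtraction on naturals from
        truncating.\<close>
      obtain m where "2 * r - 1 = Suc (2 * m)"
        using p(1) by (intro that[of "r - 1"]) auto
      then have "poly (pderiv ([:- u, 1:] ^ (2 * r - 1))) x = real (Suc (2 * m)) * (x - u) ^ (2 * m)"
        by (simp only: pderiv_power_Suc) (simp add: pderiv_pCons)
      then show "poly (pderiv ([:- u, 1:] ^ (2 * r - 1))) x * poly p x \<ge> 0"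
        using p(2)[of x] by (auto intro!: mult_nonneg_nonneg)
    qed
  qed
  moreover have ?a if ?b
    using that by (auto simp: levi_civita_def)
  ultimately show ?thesis by blast
qed

end
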